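(* Let $\diamond$ be a left-continuous t-norm with $\alpha\diamond\alpha\ge\alpha$ for all $\alpha\in[0,1]$, and let $(X,\mathcal{F},\tau_\diamond)$ be a complete PM space, where $\tau_\diamond(F,G)(x)=F(x)\diamond G(x)$ for all $F,G\in\Delta^+$ and $x\ge 0$. Let $f:X\to X$ be a continuous function. Suppose that for some natural number $m$ the $m$-fold iterate $g=f^m$ is a probabilistic TSR-contraction mapping; that is, for every $t>0$ there exists $k\in(0,1)$ such that $$1-F_{g(x),g(y)}(kt)\le k\bigl(1-F_{x,y}(t)\bigr)\quad\text{for all }x,y\in X.$$ Then $f$ has a unique fixed point in $X$.
   Context: A t-norm is a binary operation $\diamond$ on $[0,1]$ that is commutative, associative, non-decreasing in each argument, and satisfies $x\diamond 1=x$. A distance distribution function is a non-decreasing function $F:[-\infty,\infty]\to[0,1]$, left continuous on $\mathbb{R}$, with $F(-\infty)=0$, $F(\infty)=1$, $F(0)=0$; the set of these is $\Delta^+$. $H_0\in\Delta^+$ is given by $H_0(u)=0$ for $u\le 0$ and $H_0(u)=1$ for $u>0$. A triangle function is a binary operation $\tau$ on $\Delta^+$ that is commutative, associative, non-decreasing in each place (pointwise order), with identity $H_0$. A probabilistic metric space (PM space) is a triple $(X,\mathcal{F},\tau)$ with $X$ a nonempty set, $\tau$ a triangle function, and $\mathcal{F}:X\times X\to\Delta^+$, $(p,q)\mapsto F_{p,q}$, such that for all $p,q,r\in X$: (i) $F_{p,q}=H_0$ iff $p=q$; (ii) $F_{p,q}=F_{q,p}$; (iii) $F_{p,r}\ge\tau(F_{p,q},F_{q,r})$.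 A sequence $\{x_n\}$ in $X$ converges to $x\in X$ if for all $\alpha\in(0,1)$ and $t>0$ there is a natural number $m$ with $F_{x_n,x}(t)>1-\alpha$ for all $n\ge m$. It is a Cauchy sequence if for all $\alpha\in(0,1)$ and $t>0$ there is a natural number $m$ with $F_{x_{n+p},x_n}(t)>1-\alpha$ for all $n\ge m$ and all natural numbers $p$. The space is complete if every Cauchy sequence converges to a point of $X$. A map $f:X\to X$ is continuous at $a\in X$ if for every $\epsilon\in(0,1)$ and $t>0$ there exists $\delta=\delta(\epsilon,a,t)\in(0,1)$ such that, for $x\in X$, $F_{x,a}(t)>1-\delta$ implies $F_{f(x),f(a)}(t)>1-\epsilon$ (same $t$); $f$ is continuous if it is continuous at every point of $X$. The contraction constant $k$ may depend on $t$ but not on $x,y$. *)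

theory Defs
  imports Complex_Main "HOL-Library.Extended_Real" "HOL-Library.FuncSet"
begin

definition tnorm :: "(real \<Rightarrow> real \<Rightarrow> real) \<Rightarrow> bool" where
  "tnorm T \<longleftrightarrow>
     (\<forall>x\<in>{0..1}. \<forall>y\<in>{0..1}. T x y \<in> {0..1}) \<and>
     (\<forall>x\<in>{0..1}. \<forall>y\<in>{0..1}. T x y = T y x) \<and>
     (\<forall>x\<in>{0..1}. \<forall>y\<in>{0..1}. \<forall>z\<in>{0..1}. T (T x y) z = T x (T y z)) \<and>
     (\<forall>x\<in>{0..1}. \<forall>x'\<in>{0..1}. \<forall>y\<in>{0..1}.
        x \<le> x' \<longrightarrow> T x y \<le> T x' y \<and> T y x \<le> T y x') \<and>
     (\<forall>x\<in>{0..1}. T x 1 = x)"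

text \<open>Left continuity of a t-norm is meant separately in each argument. The point 0 is left out
  because it has no left neighbours in the unit interval, while \<open>at_left 0\<close> would consider the
  values of \<open>T\<close> at negative reals.\<close>

definition left_continuous_tnorm :: "(real \<Rightarrow> real \<Rightarrow> real) \<Rightarrow> bool" where
  "left_continuous_tnorm T \<longleftrightarrow> tnorm T \<and>
     (\<forall>x\<in>{0<..1}. \<forall>y\<in>{0..1}.
        continuous (at_left x) (\<lambda>u. T u y) \<and> continuous (at_left x) (\<lambda>u. T y u))"

definition Delta_plus :: "(ereal \<Rightarrow> real) set" where
  "Delta_plus = {F. mono F \<and> range F \<subseteq> {0..1} \<and>
     (\<forall>u::real. continuous (at_left (ereal u)) F) \<and>
     F (-\<infinity>) = 0 \<and> F \<infinity> = 1 \<and> F 0 = 0}"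

definition H0 :: "ereal \<Rightarrow> real" where
  "H0 u = (if u \<le> 0 then 0 else 1)"

text \<open>The relation \<open>\<le>\<close> between distribution functions is the pointwise order.\<close>

definition triangle_function ::
    "((ereal \<Rightarrow> real) \<Rightarrow> (ereal \<Rightarrow> real) \<Rightarrow> (ereal \<Rightarrow> real)) \<Rightarrow> bool" where
  "triangle_function \<tau> \<longleftrightarrow>
     (\<forall>F\<in>Delta_plus. \<forall>G\<in>Delta_plus. \<tau> F G \<in> Delta_plus) \<and>
     (\<forall>F\<in>Delta_plus. \<forall>G\<in>Delta_plus. \<tau> F G = \<tau> G F) \<and>
     (\<forall>F\<in>Delta_plus. \<forall>G\<in>Delta_plus. \<forall>H\<in>Delta_plus. \<tau> (\<tau> F G) H = \<tau> F (\<tau> G H)) \<and>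
     (\<forall>F\<in>Delta_plus. \<forall>F'\<in>Delta_plus. \<forall>G\<in>Delta_plus.
        F \<le> F' \<longrightarrow> \<tau> F G \<le> \<tau> F' G \<and> \<tau> G F \<le> \<tau> G F') \<and>
     (\<forall>F\<in>Delta_plus. \<tau> F H0 = F)"

text \<open>The operation is prescribed on \<open>x \<ge> 0\<close> only; a member of \<^const>\<open>Delta_plus\<close> vanishes at
  negative arguments, so the value there has to be 0.\<close>

definition tau_tnorm ::
    "(real \<Rightarrow> real \<Rightarrow> real) \<Rightarrow> (ereal \<Rightarrow> real) \<Rightarrow> (ereal \<Rightarrow> real) \<Rightarrow> (ereal \<Rightarrow> real)" where
  "tau_tnorm T F G = (\<lambda>x. if 0 \<le> x then T (F x) (G x) else 0)"

definition pm_space ::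
    "'a set \<Rightarrow> ('a \<Rightarrow> 'a \<Rightarrow> ereal \<Rightarrow> real)
      \<Rightarrow> ((ereal \<Rightarrow> real) \<Rightarrow> (ereal \<Rightarrow> real) \<Rightarrow> (ereal \<Rightarrow> real)) \<Rightarrow> bool" where
  "pm_space X F \<tau> \<longleftrightarrow>
     X \<noteq> {} \<and> triangle_function \<tau> \<and>
     (\<forall>p\<in>X. \<forall>q\<in>X. F p q \<in> Delta_plus) \<and>
     (\<forall>p\<in>X. \<forall>q\<in>X. F p q = H0 \<longleftrightarrow> p = q) \<and>
     (\<forall>p\<in>X. \<forall>q\<in>X. F p q = F q p) \<and>
     (\<forall>p\<in>X. \<forall>q\<in>X. \<forall>r\<in>X. \<tau> (F p q) (F q r) \<le> F p r)"

definition pm_converges ::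
    "('a \<Rightarrow> 'a \<Rightarrow> ereal \<Rightarrow> real) \<Rightarrow> (nat \<Rightarrow> 'a) \<Rightarrow> 'a \<Rightarrow> bool" where
  "pm_converges F s x \<longleftrightarrow>
     (\<forall>\<alpha>\<in>{0<..<1}. \<forall>t::real. t > 0 \<longrightarrow> (\<exists>m. \<forall>n\<ge>m. F (s n) x (ereal t) > 1 - \<alpha>))"

definition pm_Cauchy ::
    "('a \<Rightarrow> 'a \<Rightarrow> ereal \<Rightarrow> real) \<Rightarrow> (nat \<Rightarrow> 'a) \<Rightarrow> bool" where
  "pm_Cauchy F s \<longleftrightarrow>
     (\<forall>\<alpha>\<in>{0<..<1}. \<forall>t::real. t > 0 \<longrightarrow>
        (\<exists>m. \<forall>n\<ge>m. \<forall>p. F (s (n + p)) (s n) (ereal t) > 1 - \<alpha>))"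

definition pm_complete :: "'a set \<Rightarrow> ('a \<Rightarrow> 'a \<Rightarrow> ereal \<Rightarrow> real) \<Rightarrow> bool" where
  "pm_complete X F \<longleftrightarrow>
     (\<forall>s. range s \<subseteq> X \<longrightarrow> pm_Cauchy F s \<longrightarrow> (\<exists>x\<in>X. pm_converges F s x))"

definition pm_continuous_at ::
    "'a set \<Rightarrow> ('a \<Rightarrow> 'a \<Rightarrow> ereal \<Rightarrow> real) \<Rightarrow> ('a \<Rightarrow> 'a) \<Rightarrow> 'a \<Rightarrow> bool" where
  "pm_continuous_at X F f a \<longleftrightarrow>
     (\<forall>\<epsilon>\<in>{0<..<1}. \<forall>t::real. t > 0 \<longrightarrow>
        (\<exists>\<delta>\<in>{0<..<1}. \<forall>x\<in>X.
           F x a (ereal t) > 1 - \<delta> \<longrightarrow> F (f x) (f a) (ereal t) > 1 - \<epsilon>))"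

definition pm_continuous ::
    "'a set \<Rightarrow> ('a \<Rightarrow> 'a \<Rightarrow> ereal \<Rightarrow> real) \<Rightarrow> ('a \<Rightarrow> 'a) \<Rightarrow> bool" where
  "pm_continuous X F f \<longleftrightarrow> (\<forall>a\<in>X. pm_continuous_at X F f a)"

definition tsr_contraction ::
    "'a set \<Rightarrow> ('a \<Rightarrow> 'a \<Rightarrow> ereal \<Rightarrow> real) \<Rightarrow> ('a \<Rightarrow> 'a) \<Rightarrow> bool" where
  "tsr_contraction X F g \<longleftrightarrow>
     (\<forall>t::real. t > 0 \<longrightarrow> (\<exists>k\<in>{0<..<1}. \<forall>x\<in>X. \<forall>y\<in>X.
        1 - F (g x) (g y) (ereal (k * t)) \<le> k * (1 - F x y (ereal t))))"

end

theory Submission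
  imports Defs
begin

text \<open>A t-norm with \<open>\<alpha> \<diamond> \<alpha> \<ge> \<alpha>\<close> dominates the minimum, so for every \<open>t > 0\<close> the map
  \<open>d\<^sub>t(x, y) = 1 - F\<^bsub>x,y\<^esub>(t)\<close> is a pseudo-ultrametric. Since \<open>k t \<le> t\<close> and \<open>d\<^sub>t\<close> decreases in \<open>t\<close>, the
  map \<open>g = f\<^sup>m\<close> is an ordinary contraction of each \<open>d\<^sub>t\<close>, with constant \<open>k = k(t)\<close>. By the ultrametric
  inequality \<open>d\<^sub>t(g\<^bsup>n+p\<^esup> x, g\<^sup>n x) \<le> k\<^sup>n\<close>, so the orbits of \<open>g\<close> are Cauchy and converge to the unique
  fixed point of \<open>g\<close>, which \<open>f\<close> must fix because it commutes with \<open>g\<close>.\<close>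

text \<open>Lowering both arguments to their minimum \<open>c\<close> can only decrease
  \<open>T\<close>, and \<open>T c c\<close> is still at least \<open>c\<close>.\<close>

lemma tnorm_ge_min:
  assumes "tnorm T" "\<forall>\<alpha>\<in>{0..1}. T \<alpha> \<alpha> \<ge> \<alpha>" "a \<in> {0..1}" "b \<in> {0..1}"
  shows "min a b \<le> T a b"
proof -
  define c where "c = min a b"
  have mono: "x \<le> x' \<Longrightarrow> T x y \<le> T x' y \<and> T y x \<le> T y x'"
    if "x \<in> {0..1}" "x' \<in> {0..1}" "y \<in> {0..1}" for x x' y
    using assms(1) that unfolding tnorm_def by blast
  have c: "c \<in> {0..1}" "c \<le> a" "c \<le> b"
    using assms(3,4) by (auto simp: c_def)
  have "c \<le> T c c"
    using assms(2) c by blast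
  also have "\<dots> \<le> T a c"
    using mono c assms(3) by blast
  also have "\<dots> \<le> T a b"
    using mono c assms(3,4) by blast
  finally show ?thesis
    by (simp add: c_def)
qed

text \<open>\<open>tau_tnorm\<close> combines both distribution functions at the same argument, so
  the triangle inequality becomes an ultrametric one for \<open>1 - F\<close> at each fixed
  \<open>u\<close>.\<close>

lemma pm_space_ge_min:
  assumes "tnorm T" "\<forall>\<alpha>\<in>{0..1}. T \<alpha> \<alpha> \<ge> \<alpha>" "pm_space X F (tau_tnorm T)"
    and "p \<in> X" "q \<in> X" "r \<in> X" "0 \<le> u"
  shows "min (F p q u) (F q r u) \<le> F p r u"
proof -
  have "F p q \<in> Delta_plus" "F q r \<in> Delta_plus"
    using assms(3-6) unfolding pm_space_def by auto
  then have "F p q u \<in> {0..1}" "F q r u \<in> {0..1}"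
    unfolding Delta_plus_def by blast+
  then have "min (F p q u) (F q r u) \<le> T (F p q u) (F q r u)"
    using tnorm_ge_min assms(1,2) by blast
  also have "\<dots> = tau_tnorm T (F p q) (F q r) u"
    using assms(7) by (simp add: tau_tnorm_def)
  also have "\<dots> \<le> F p r u"
    using assms(3-6) unfolding pm_space_def by (auto simp: le_fun_def)
  finally show ?thesis .
qed

text \<open>Reduces equality of points to finite positive arguments: monotonicity and
  \<open>G 0 = 0\<close> settle \<open>u \<le> 0\<close>, and the value at infinity is
  prescribed.\<close>

lemma Delta_plus_eq_H0:
  assumes "G \<in> Delta_plus" "\<And>t::real. t > 0 \<Longrightarrow> G (ereal t) = 1"
  shows "G = H0"
proof
  fix u
  have G: "mono G" "range G \<subseteq> {0..1}" "G \<infinity> = 1" "G 0 = 0"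
    using assms(1) by (auto simp: Delta_plus_def)
  show "G u = H0 u"
  proof (cases "u \<le> 0")
    case True
    then have "G u \<le> 0"
      using monoD[OF G(1) True] G(4) by simp
    moreover have "0 \<le> G u"
      using G(2) by (auto simp: image_subset_iff)
    ultimately show ?thesis
      using True by (simp add: H0_def)
  next
    case False
    then show ?thesis
      using assms(2) G(3) by (cases u) (auto simp: H0_def)
  qed
qed

lemma pm_space_eqI:
  assumes "pm_space X F \<tau>" "p \<in> X" "q \<in> X"
    and "\<And>t::real. t > 0 \<Longrightarrow> F p q (ereal t) = 1"
  shows "p = q"
proof -
  have "F p q \<in> Delta_plus"
    using assms(1-3) by (auto simp: pm_space_def)
  then have "F p q = H0"
    using assms(4) by (rule Delta_plus_eq_H0)
  then show ?thesis
    using assms(1-3) by (auto simp: pm_space_def)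
qed

text \<open>Since \<open>k\<close> depends on \<open>t\<close>, iterating the hypothesis as given
  would change both at every step. With \<open>t\<close> kept on both sides, one \<open>k\<close>
  serves all iterates.\<close>

lemma tsr_contraction_same_argument:
  assumes "pm_space X F \<tau>" "g \<in> X \<rightarrow> X" "tsr_contraction X F g" "t > 0"
  obtains k where "k \<in> {0<..<1}"
    "\<And>x y. x \<in> X \<Longrightarrow> y \<in> X \<Longrightarrow>
       1 - F (g x) (g y) (ereal t) \<le> k * (1 - F x y (ereal t))"
proof -
  obtain k where k: "k \<in> {0<..<1}" "\<And>x y. x \<in> X \<Longrightarrow> y \<in> X \<Longrightarrow>
      1 - F (g x) (g y) (ereal (k * t)) \<le> k * (1 - F x y (ereal t))"
    using assms(3,4) unfolding tsr_contraction_def by blast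
  have "1 - F (g x) (g y) (ereal t) \<le> k * (1 - F x y (ereal t))"
    if "x \<in> X" "y \<in> X" for x y
  proof -
    have "g x \<in> X" "g y \<in> X"
      using assms(2) that by auto
    then have "mono (F (g x) (g y))"
      using assms(1) by (auto simp: pm_space_def Delta_plus_def)
    moreover have "ereal (k * t) \<le> ereal t"
      using k(1) assms(4) by simp
    ultimately have "F (g x) (g y) (ereal (k * t)) \<le> F (g x) (g y) (ereal t)"
      by (rule monoD)
    then show ?thesis
      using k(2)[OF that] by linarith
  qed
  with k(1) show thesis
    by (rule that)
qed

lemma funpow_closed: "f \<in> X \<rightarrow> X \<Longrightarrow> f ^^ n \<in> X \<rightarrow> X"
  by (induction n) auto

lemma tsr_contraction_unique_fixed_point:
  assumes "tnorm T" "\<forall>\<alpha>\<in>{0..1}. T \<alpha> \<alpha> \<ge> \<alpha>" "pm_space X F (tau_tnorm T)"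
    and "pm_complete X F" "g \<in> X \<rightarrow> X" "tsr_contraction X F g"
  shows "\<exists>!x. x \<in> X \<and> g x = x"
proof -
  note contraction = tsr_contraction_same_argument[OF assms(3,5,6)]
  have F01: "F p q u \<in> {0..1}" if "p \<in> X" "q \<in> X" for p q u
    using assms(3) that unfolding pm_space_def Delta_plus_def by blast
  have sym: "F p q = F q p" if "p \<in> X" "q \<in> X" for p q
    using assms(3) that unfolding pm_space_def by blast
  have ultra: "min (F p q (ereal t)) (F q r (ereal t)) \<le> F p r (ereal t)"
    if "p \<in> X" "q \<in> X" "r \<in> X" "t > 0" for p q r t
    using that by (intro pm_space_ge_min[OF assms(1-3)]) auto
  obtain x0 where x0: "x0 \<in> X"
    using assms(3) unfolding pm_space_def by blast
  define s where "s n = (g ^^ n) x0" for n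
  have s: "s n \<in> X" for n
    using funpow_closed[OF assms(5), of n] x0 by (auto simp: s_def)
  have s_Suc: "s (Suc n) = g (s n)" for n
    by (simp add: s_def)
  have "pm_Cauchy F s"
    unfolding pm_Cauchy_def
  proof (intro ballI allI impI)
    fix \<alpha> t :: real
    assume \<alpha>: "\<alpha> \<in> {0<..<1}" and t: "t > 0"
    obtain k where k: "k \<in> {0<..<1}" "\<And>x y. x \<in> X \<Longrightarrow> y \<in> X \<Longrightarrow>
        1 - F (g x) (g y) (ereal t) \<le> k * (1 - F x y (ereal t))"
      using contraction[OF t] by blast
    \<comment> \<open>The pair arises by applying \<open>g\<close> \<open>n\<close> times to
      \<open>s p\<close> and \<open>s 0\<close>, whose distance \<open>1 - F\<close> is at most 1
      whatever \<open>p\<close> is; hence the bound is uniform in \<open>p\<close>.\<close>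
    have bound: "1 - F (s (n + p)) (s n) (ereal t) \<le> k ^ n" for n p
    proof (induction n)
      case 0
      then show ?case
        using F01[OF s s] by simp
    next
      case (Suc n)
      have "1 - F (s (Suc n + p)) (s (Suc n)) (ereal t)
          \<le> k * (1 - F (s (n + p)) (s n) (ereal t))"
        using k(2)[OF s s] by (simp add: s_Suc)
      also have "\<dots> \<le> k * k ^ n"
        using Suc k(1) by (intro mult_left_mono) auto
      finally show ?case
        by simp
    qed
    obtain N where N: "k ^ N < \<alpha>"
      using real_arch_pow_inv[of \<alpha> k] \<alpha> k(1) by auto
    have "F (s (n + p)) (s n) (ereal t) > 1 - \<alpha>" if "n \<ge> N" for n p
    proof -
      have "k ^ n \<le> k ^ N"
        using that k(1) by (intro power_decreasing) auto
      then show ?thesis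
        using bound[of n p] N by linarith
    qed
    then show "\<exists>N. \<forall>n\<ge>N. \<forall>p. F (s (n + p)) (s n) (ereal t) > 1 - \<alpha>"
      by blast
  qed
  then obtain x where x: "x \<in> X" "pm_converges F s x"
    using assms(4) s unfolding pm_complete_def by blast
  then have gx: "g x \<in> X"
    using assms(5) by blast
  have "F (g x) x (ereal t) = 1" if t: "t > 0" for t
  proof -
    obtain k where k: "k \<in> {0<..<1}" "\<And>x y. x \<in> X \<Longrightarrow> y \<in> X \<Longrightarrow>
        1 - F (g x) (g y) (ereal t) \<le> k * (1 - F x y (ereal t))"
      using contraction[OF t] by blast
    \<comment> \<open>The intermediate point is \<open>s (Suc N)\<close>: it is close to
      \<open>x\<close> by convergence, and close to \<open>g x\<close> because \<open>g\<close> does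
      not increase the distance from \<open>s N\<close> to \<open>x\<close>.\<close>
    have "1 - \<alpha> \<le> F (g x) x (ereal t)" if \<alpha>: "\<alpha> \<in> {0<..<1}" for \<alpha>
    proof -
      obtain N where N: "\<And>n. n \<ge> N \<Longrightarrow> F (s n) x (ereal t) > 1 - \<alpha>"
        using x(2) \<alpha> t unfolding pm_converges_def by blast
      have "k * (1 - F (s N) x (ereal t)) \<le> 1 * (1 - F (s N) x (ereal t))"
        using k(1) F01[OF s x(1), of N] by (intro mult_right_mono) auto
      then have "F (s (Suc N)) (g x) (ereal t) > 1 - \<alpha>"
        using k(2)[OF s x(1), of N] N[of N] unfolding s_Suc by simp
      moreover have "F (s (Suc N)) x (ereal t) > 1 - \<alpha>"
        using N by simp
      ultimately show ?thesis
        using ultra[OF gx s x(1) t, of "Suc N"] sym[OF gx s] by auto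
    qed
    \<comment> \<open>Now \<alpha> tends to 0 within (0,1), by density of the order.\<close>
    then have "\<alpha> \<ge> 1 - F (g x) x (ereal t)" if "0 < \<alpha>" "\<alpha> < 1" for \<alpha>
      using that by force
    then have "1 - F (g x) x (ereal t) \<le> 0"
      by (rule dense_ge_bounded[of 0 1, rotated]) auto
    then show ?thesis
      using F01[OF gx x(1), of "ereal t"] by simp
  qed
  then have fixed: "g x = x"
    by (rule pm_space_eqI[OF assms(3) gx x(1)])
  have "y = x" if y: "y \<in> X" "g y = y" for y
  proof (rule pm_space_eqI[OF assms(3) y(1) x(1)])
    fix t :: real
    assume t: "t > 0"
    obtain k where k: "k \<in> {0<..<1}" "\<And>x y. x \<in> X \<Longrightarrow> y \<in> X \<Longrightarrow>
        1 - F (g x) (g y) (ereal t) \<le> k * (1 - F x y (ereal t))"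
      using contraction[OF t] by blast
    \<comment> \<open>Both points are fixed, so their distance is at most \<open>k\<close> times
      itself, which forces it to vanish.\<close>
    have "(1 - k) * (1 - F y x (ereal t)) \<le> 0"
      using k(2)[OF y(1) x(1)] y(2) fixed by (simp add: algebra_simps)
    then have "1 - F y x (ereal t) \<le> 0"
      using k(1) by (simp add: mult_le_0_iff)
    then show "F y x (ereal t) = 1"
      using F01[OF y(1) x(1), of "ereal t"] by simp
  qed
  with x(1) fixed show ?thesis
    by blast
qed

text \<open>\<open>f\<close> sends a fixed point of its iterate to another one, so the only one must
  stay put; uniqueness passes down because every fixed point of \<open>f\<close> is fixed by
  \<open>f ^^ m\<close>.\<close>

lemma unique_fixed_point_of_funpow:
  assumes "f \<in> X \<rightarrow> X" "\<exists>!x. x \<in> X \<and> (f ^^ m) x = x"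
  shows "\<exists>!x. x \<in> X \<and> f x = x"
proof -
  obtain x where x: "x \<in> X" "(f ^^ m) x = x"
    and uniq: "\<And>y. y \<in> X \<Longrightarrow> (f ^^ m) y = y \<Longrightarrow> y = x"
    using assms(2) by blast
  have "(f ^^ m) (f x) = f x"
    using x(2) by (metis funpow_swap1)
  then have "f x = x"
    using uniq assms(1) x(1) by blast
  moreover have "(f ^^ m) y = y" if "f y = y" for y
    using that by (induction m) auto
  ultimately show ?thesis
    using x(1) uniq by blast
qed

theorem theorem4p6:
  fixes T :: "real \<Rightarrow> real \<Rightarrow> real"
    and X :: "'a set"
    and F :: "'a \<Rightarrow> 'a \<Rightarrow> ereal \<Rightarrow> real"
    and f :: "'a \<Rightarrow> 'a"
    and m :: nat
  assumes "left_continuous_tnorm T"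
    and "\<forall>\<alpha>\<in>{0..1}. T \<alpha> \<alpha> \<ge> \<alpha>"
    and "pm_space X F (tau_tnorm T)"
    and "pm_complete X F"
    and "f \<in> X \<rightarrow> X"
    and "pm_continuous X F f"
    and "m \<ge> 1"
    and "tsr_contraction X F (f ^^ m)"
  shows "\<exists>!x. x \<in> X \<and> f x = x"
proof -
  have "tnorm T"
    using assms(1) by (simp add: left_continuous_tnorm_def)
  then have "\<exists>!x. x \<in> X \<and> (f ^^ m) x = x"
    using assms(2-4) funpow_closed[OF assms(5)] assms(8)
    by (rule tsr_contraction_unique_fixed_point)
  with assms(5) show ?thesis
    by (rule unique_fixed_point_of_funpow)
qed

end
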